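(* Let $n$ be a positive integer with binary representation $n = \sum_{k \geq 0} a_k 2^k$ (each $a_k \in \{0,1\}$, all but finitely many zero), and let $\gamma$ be the exponent of the highest power of $2$ dividing $n!$. Then $n! = 2^{\gamma} Z$, where $Z$ is odd and satisfies $$Z \equiv 3^{\alpha_3(n)} (-1)^{\alpha_5(n)} \pmod{8}.$$
   Context: For a positive integer $n = \sum_{k \geq 0} a_k 2^k$ in binary, define $\alpha_3(n) := \#\{ k \geq 0 : \sum_{i=k}^{k+2} a_i 2^{i-k} \in \{3,4\} \}$ and $\alpha_5(n) := \#\{ k \geq 0 : \sum_{i=k}^{k+2} a_i 2^{i-k} \in \{5,6\} \}$, i.e. the number of positions $k$ at which the 3-bit window $(a_{k+2}a_{k+1}a_k)_2$ has value in $\{3,4\}$, respectively $\{5,6\}$. By Legendre's formula, $\gamma = n - \sum_{k\ge 0} a_k$. *)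

theory Defs
  imports "HOL-Number_Theory.Number_Theory"
begin

definition is_binary_rep :: "(nat \<Rightarrow> nat) \<Rightarrow> nat \<Rightarrow> bool" where
  "is_binary_rep a n \<longleftrightarrow>
     (\<forall>k. a k \<in> {0, 1}) \<and> finite {k. a k \<noteq> 0} \<and> n = (\<Sum>k | a k \<noteq> 0. a k * 2 ^ k)"

definition window3 :: "(nat \<Rightarrow> nat) \<Rightarrow> nat \<Rightarrow> nat" where
  "window3 a k = (\<Sum>i = k..k + 2. a i * 2 ^ (i - k))"

text \<open>
  The counting functions below take the digit sequence of a number rather than the number itself.
  For a sequence \<open>a\<close> of finite support, windows of nonzero value start at only finitely many
  positions, so the cardinalities are genuine.
\<close>

definition alpha3 :: "(nat \<Rightarrow> nat) \<Rightarrow> nat" where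
  "alpha3 a = card {k. window3 a k \<in> {3, 4}}"

definition alpha5 :: "(nat \<Rightarrow> nat) \<Rightarrow> nat" where
  "alpha5 a = card {k. window3 a k \<in> {5, 6}}"

end

theory Submission
  imports Defs
begin

text \<open>
  Splitting off the even factors gives \<open>n! = 2^(n div 2) (n div 2)! Q(n)\<close>, where \<open>Q(n)\<close> is the
  product of the odd numbers up to \<open>n\<close>. Four consecutive odd numbers multiply to \<open>1\<close> modulo \<open>8\<close>,
  so \<open>Q(n)\<close> modulo \<open>8\<close> depends only on \<open>n mod 8\<close>, that is, on the lowest window: it is \<open>3\<close> for the
  values \<open>3, 4\<close>, it is \<open>-1\<close> for \<open>5, 6\<close>, and \<open>1\<close> otherwise. Passing to \<open>n div 2\<close> shifts the digits
  by one, so an induction collects one such factor per window.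
\<close>

text \<open>Modulo \<open>8\<close> the factors run cyclically through 1, 3, 5, 7, with partial
  products 1, 3, 15 = -1 and 105 = 1. The cast to \<open>int\<close> makes room for the value
  -1.\<close>

lemma prod_odd_mod_8:
  "[int (\<Prod>i<r. 2 * i + 1) = (if r mod 4 = 2 then 3 else if r mod 4 = 3 then - 1 else 1)] (mod 8)"
proof (induction r)
  case 0
  then show ?case by simp
next
  case (Suc r)
  let ?c = "\<lambda>r. if r mod 4 = 2 then 3 else if r mod 4 = 3 then - 1 else 1 :: int"
  have "r = 4 * (r div 4) + r mod 4"
    by simp
  then have "int (2 * r + 1) = 2 * int (r mod 4) + 1 + 8 * int (r div 4)"
    by linarith
  then have "[int (2 * r + 1) = 2 * int (r mod 4) + 1] (mod 8)"
    by (simp only: cong_def mod_mult_self2)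
  then have "[int (\<Prod>i<Suc r. 2 * i + 1) = ?c r * (2 * int (r mod 4) + 1)] (mod 8)"
    unfolding prod.lessThan_Suc of_nat_mult by (rule cong_mult[OF Suc.IH])
  moreover have "[?c r * (2 * int (r mod 4) + 1) = ?c (Suc r)] (mod 8)"
  proof -
    have "r mod 4 = 0 \<or> r mod 4 = 1 \<or> r mod 4 = 2 \<or> r mod 4 = 3"
      by presburger
    then show ?thesis
      by (auto simp: mod_Suc cong_def)
  qed
  ultimately show ?case by (rule cong_trans)
qed

lemma fact_double_eq_odd_prod:
  "(fact (2 * m) :: nat) = 2 ^ m * fact m * (\<Prod>i<m. 2 * i + 1)"
  by (induction m) (simp_all add: algebra_simps)

lemma fact_eq_odd_prod:
  "(fact n :: nat) = 2 ^ (n div 2) * fact (n div 2) * (\<Prod>i<(n + 1) div 2. 2 * i + 1)"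
proof (cases "even n")
  case True
  then obtain m where "n = 2 * m" by blast
  then show ?thesis by (simp add: fact_double_eq_odd_prod)
next
  case False
  then obtain m where n: "n = 2 * m + 1" using oddE by blast
  \<comment> \<open>For odd \<open>n\<close> the extra factor \<open>n\<close> itself is the last
    factor of the odd product.\<close>
  then have "(fact n :: nat) = (2 * m + 1) * fact (2 * m)" by simp
  also have "\<dots> = 2 ^ m * fact m * (\<Prod>i<Suc m. 2 * i + 1)"
    unfolding fact_double_eq_odd_prod prod.lessThan_Suc by (simp only: mult_ac)
  finally have "(fact n :: nat) = 2 ^ m * fact m * (\<Prod>i<Suc m. 2 * i + 1)" .
  moreover have "n div 2 = m" "(n + 1) div 2 = Suc m"
    using n by simp_all
  ultimately show ?thesis by (simp only:)
qed

lemma is_binary_rep_0: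
  assumes "is_binary_rep a 0"
  shows "a k = 0"
  using assms unfolding is_binary_rep_def by (auto)

text \<open>Dropping the lowest digit is halving; this carries the digit sequence through the
  induction step from \<open>n\<close> to \<open>n div 2\<close>.\<close>

lemma is_binary_rep_shift:
  assumes "is_binary_rep a n"
  shows "is_binary_rep (\<lambda>k. a (Suc k)) (n div 2)" "a 0 = n mod 2"
proof -
  have bit: "a k = 0 \<or> a k = 1" for k
    using assms unfolding is_binary_rep_def by auto
  have fin: "finite {k. a k \<noteq> 0}" and n: "n = (\<Sum>k | a k \<noteq> 0. a k * 2 ^ k)"
    using assms unfolding is_binary_rep_def by blast+
  \<comment> \<open>A common bound turns both sums over supports into sums over initial segments,
    where the index can be shifted.\<close>
  obtain N where N: "{k. a k \<noteq> 0} \<subseteq> {..<N}"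
    using fin finite_nat_iff_bounded by blast
  then have N': "{k. a (Suc k) \<noteq> 0} \<subseteq> {..<N}"
    by (auto dest: Suc_lessD)
  let ?s = "\<Sum>k | a (Suc k) \<noteq> 0. a (Suc k) * 2 ^ k"
  have "n = (\<Sum>k<Suc N. a k * 2 ^ k)"
    unfolding n using N by (intro sum.mono_neutral_left) (auto intro: less_SucI)
  also have "\<dots> = a 0 + 2 * (\<Sum>k<N. a (Suc k) * 2 ^ k)"
    by (simp only: sum.lessThan_Suc_shift) (simp add: sum_distrib_left mult_ac)
  also have "(\<Sum>k<N. a (Suc k) * 2 ^ k) = ?s"
    using N' by (intro sum.mono_neutral_right) auto
  finally have *: "n = a 0 + 2 * ?s" .
  then have "n div 2 = ?s"
    using bit[of 0] by auto
  moreover have "finite {k. a (Suc k) \<noteq> 0}"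
    using N' finite_subset by blast
  ultimately show "is_binary_rep (\<lambda>k. a (Suc k)) (n div 2)"
    using bit unfolding is_binary_rep_def by blast
  show "a 0 = n mod 2"
    using * bit[of 0] by auto
qed

lemma window3_unfold: "window3 a k = a k + 2 * a (Suc k) + 4 * a (Suc (Suc k))"
proof -
  have "{k..k + 2} = {k, Suc k, Suc (Suc k)}"
    by auto
  then show ?thesis
    by (simp add: window3_def)
qed

lemma window3_0_eq_mod:
  assumes "is_binary_rep a n"
  shows "window3 a 0 = n mod 8"
proof -
  note 1 = is_binary_rep_shift[OF assms]
  note 2 = is_binary_rep_shift[OF 1(1)]
  note 3 = is_binary_rep_shift[OF 2(1)]
  have "window3 a 0 = n mod 2 + 2 * (n div 2 mod 2) + 4 * (n div 2 div 2 mod 2)"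
    by (simp only: window3_unfold 1(2) 2(2) 3(2))
  also have "\<dots> = n mod 8"
    using mod_mult2_eq[of n 2 4] mod_mult2_eq[of "n div 2" 2 2] by simp
  finally show ?thesis .
qed

text \<open>A nonzero window at \<open>k\<close> has a nonzero digit at \<open>k\<close>,
  \<open>k + 1\<close> or \<open>k + 2\<close>. Finiteness matters since \<open>card\<close> of an
  infinite set is 0, which would spoil the recursion for the counts.\<close>

lemma finite_window3:
  assumes "is_binary_rep a n" "0 \<notin> S"
  shows "finite {k. window3 a k \<in> S}"
proof -
  have fin: "finite {k. a k \<noteq> 0}"
    using assms(1) unfolding is_binary_rep_def by auto
  have "finite ({k. a k \<noteq> 0} \<union> (\<lambda>k. k + 1) -` {k. a k \<noteq> 0} \<union> (\<lambda>k. k + 2) -` {k. a k \<noteq> 0})"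
    using fin by (intro finite_UnI finite_vimageI) (auto simp: inj_def)
  moreover have "{k. window3 a k \<in> S} \<subseteq>
      {k. a k \<noteq> 0} \<union> (\<lambda>k. k + 1) -` {k. a k \<noteq> 0} \<union> (\<lambda>k. k + 2) -` {k. a k \<noteq> 0}"
    using assms(2) by (auto simp: window3_unfold intro!: gr0I)
  ultimately show ?thesis
    by (rule rev_finite_subset)
qed

lemma card_Collect_nat_shift:
  fixes P :: "nat \<Rightarrow> bool"
  assumes "finite {k. P k}"
  shows "card {k. P k} = (if P 0 then 1 else 0) + card {k. P (Suc k)}"
proof -
  have split: "{k. P k} = (if P 0 then {0} else {}) \<union> Suc ` {k. P (Suc k)}"
    by (auto simp: image_iff) (metis not0_implies_Suc)+
  have "finite (Suc ` {k. P (Suc k)})"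
    using assms by (rule rev_finite_subset) auto
  then show ?thesis
    by (subst split) (auto simp: card_image)
qed

text \<open>With \<open>S\<close> equal to \<open>{3, 4}\<close> or \<open>{5, 6}\<close> this is
  the recursion for \<open>alpha3\<close> or \<open>alpha5\<close> under halving.\<close>

lemma card_window3_shift:
  assumes "is_binary_rep a n" "0 \<notin> S"
  shows "card {k. window3 a k \<in> S} =
    (if n mod 8 \<in> S then 1 else 0) + card {k. window3 (\<lambda>k. a (Suc k)) k \<in> S}"
  using card_Collect_nat_shift[OF finite_window3[OF assms]] window3_0_eq_mod[OF assms(1)]
  by (simp add: window3_unfold)

text \<open>The exponent is left existential, so that the induction merely adds exponents; the case
  of 0 is included as its base.\<close>

lemma fact_odd_part_mod_8:
  assumes "is_binary_rep a n"
  shows "\<exists>g Z. (fact n :: nat) = 2 ^ g * Z \<and> odd Z \<and>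
    [int Z = 3 ^ alpha3 a * (- 1) ^ alpha5 a] (mod 8)"
  using assms
proof (induction n arbitrary: a rule: less_induct)
  case (less n)
  show ?case
  proof (cases "n = 0")
    case True
    then have "a k = 0" for k
      using less.prems is_binary_rep_0 by blast
    then show ?thesis
      using True by (auto simp: alpha3_def alpha5_def window3_unfold intro!: exI[of _ 0] exI[of _ 1])
  next
    case False
    let ?b = "\<lambda>k. a (Suc k)"
    let ?Q = "\<Prod>i<(n + 1) div 2. 2 * i + 1 :: nat"
    define e3 e5 :: nat where "e3 = (if n mod 8 \<in> {3, 4} then 1 else 0)"
      and "e5 = (if n mod 8 \<in> {5, 6} then 1 else 0)"
    obtain g Z where Z: "(fact (n div 2) :: nat) = 2 ^ g * Z" "odd Z"
      "[int Z = 3 ^ alpha3 ?b * (- 1) ^ alpha5 ?b] (mod 8)"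
      using less.IH[OF _ is_binary_rep_shift(1)[OF less.prems]] False by auto
    \<comment> \<open>The number of odd factors modulo 4 is determined by \<open>n mod 8\<close>,
      the lowest window.\<close>
    have "(n mod 8 \<in> {3, 4}) = ((n + 1) div 2 mod 4 = 2)"
      "(n mod 8 \<in> {5, 6}) = ((n + 1) div 2 mod 4 = 3)"
      unfolding insert_iff empty_iff by presburger+
    then have "[int ?Q = 3 ^ e3 * (- 1) ^ e5] (mod 8)"
      using prod_odd_mod_8[of "(n + 1) div 2"] by (auto simp: e3_def e5_def split: if_splits)
    then have "[int (?Q * Z) = 3 ^ e3 * (- 1) ^ e5 * (3 ^ alpha3 ?b * (- 1) ^ alpha5 ?b)] (mod 8)"
      unfolding of_nat_mult using Z(3) by (rule cong_mult)
    also have "3 ^ e3 * (- 1) ^ e5 * (3 ^ alpha3 ?b * (- 1) ^ alpha5 ?b) =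
        (3 ^ alpha3 a * (- 1) ^ alpha5 a :: int)"
      using card_window3_shift[OF less.prems, of "{3, 4}"]
        card_window3_shift[OF less.prems, of "{5, 6}"]
      by (simp add: alpha3_def alpha5_def e3_def e5_def power_add)
    finally have "[int (?Q * Z) = 3 ^ alpha3 a * (- 1) ^ alpha5 a] (mod 8)" .
    moreover have "(fact n :: nat) = 2 ^ (n div 2 + g) * (?Q * Z)"
      using fact_eq_odd_prod[of n] Z(1) by (simp add: power_add mult_ac)
    moreover have "odd (?Q * Z)"
      using Z(2) by (simp add: even_prod_iff)
    ultimately show ?thesis by blast
  qed
qed

theorem theorem8:
  fixes n \<gamma> :: nat and a :: "nat \<Rightarrow> nat"
  assumes "n > 0"
    and "is_binary_rep a n"
    and "\<gamma> = multiplicity 2 (fact n :: nat)"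
  shows "\<exists>Z :: nat. fact n = 2 ^ \<gamma> * Z \<and> odd Z \<and>
           [int Z = 3 ^ alpha3 a * (- 1) ^ alpha5 a] (mod 8)"
proof -
  obtain g Z where Z: "(fact n :: nat) = 2 ^ g * Z" "odd Z"
    "[int Z = 3 ^ alpha3 a * (- 1) ^ alpha5 a] (mod 8)"
    using fact_odd_part_mod_8[OF assms(2)] by blast
  \<comment> \<open>Since \<open>Z\<close> is odd, \<open>2 ^ g\<close> is the full power of 2 in
    \<open>fact n\<close>.\<close>
  have "\<gamma> = g"
    unfolding assms(3) using Z(1,2) by (intro multiplicity_eqI) auto
  with Z show ?thesis by blast
qed

end
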